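(* Let $\alpha>0$, $\beta>1/2$ and $D\ge 0$. There exist constants $c>0$ and $E\ge 0$, depending only on $\alpha,\beta,D$, such that the following holds. Suppose $\mathcal{A}$ is a set of $n$ real numbers with $|\mathcal{A}+\mathcal{A}|\le n^{2-\alpha}$ and $$(\log n)^{-D} n^{2-\beta}\le |\mathcal{A}\mathcal{A}|\le (\log n)^{D} n^{2-\beta}.$$ Then there exist a set $\mathcal{B}$ of $N>n$ real numbers, a parameter $M$ with $$c(\log N)^{-E}N^{\frac{\beta}{3-\beta}}\le M\le c^{-1}(\log N)^{E}N^{\frac{2-\beta}{3-\beta}},$$ and a graph $G_N'$ with vertex set $\mathcal{B}$ having at least $c(\log N)^{-E}M^{1/2}N^{\frac{4+\beta}{6-2\beta}}$ edges such that $$|\mathcal{B}/_{G_N'}\mathcal{B}|\le c^{-1}(\log N)^{E}\,M N^{\frac{1}{3-\beta}}\quad\text{and}\quad |\mathcal{B}+_{G_N'}\mathcal{B}|\le c^{-1}(\log N)^{E}\,N^{\frac{2-\alpha}{3-\beta}}.$$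
   Context: For a finite set $\mathcal{A}$ of reals, $\mathcal{A}+\mathcal{A}=\{a+b:a,b\in\mathcal{A}\}$ and $\mathcal{A}\mathcal{A}=\{ab:a,b\in\mathcal{A}\}$. For a graph $G$ whose vertices are the elements of a set $\mathcal{B}$, $\mathcal{B}+_{G}\mathcal{B}=\{a+b:\{a,b\}\in E(G)\}$ and $\mathcal{B}/_{G}\mathcal{B}=\{a/b:\{a,b\}\in E(G)\}$, where each edge $\{a,b\}$ contributes both ratios $a/b$ and $b/a$. *)

theory Defs
  imports Complex_Main "HOL-Library.Set_Algebras"
begin

text \<open>
  A finite simple graph is given by its vertex set and its set of edges, the edges being
  two-element subsets of the vertex set. The sets \<open>A + A\<close> and \<open>A * A\<close> are the elementwise
  ones of \<^theory>\<open>HOL-Library.Set_Algebras\<close>.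
\<close>

definition simple_graph :: "'a set \<Rightarrow> 'a set set \<Rightarrow> bool" where
  "simple_graph V E \<longleftrightarrow> finite V \<and> (\<forall>e\<in>E. e \<subseteq> V \<and> card e = 2)"

definition graph_sumset :: "real set set \<Rightarrow> real set" where
  "graph_sumset E = {a + b | a b. {a, b} \<in> E}"

text \<open>
  As \<open>{a, b} = {b, a}\<close>, every edge contributes both \<open>a / b\<close> and \<open>b / a\<close>. These ratios are
  meaningful only if no edge contains \<open>0\<close>.
\<close>

definition graph_ratioset :: "real set set \<Rightarrow> real set" where
  "graph_ratioset E = {a / b | a b. {a, b} \<in> E}"

text \<open>
  The factor \<open>(log x)\<^sup>d\<close>. The exponent \<open>0\<close> is treated separately because \<open>0 powr 0 = 0\<close>,
  whereas \<open>(log 1)\<^sup>0\<close> has to be \<open>1\<close>.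
\<close>

definition log_pow :: "real \<Rightarrow> real \<Rightarrow> real" where
  "log_pow x d = (if d = 0 then 1 else ln x powr d)"

end

theory Submission
  imports Defs "HOL-Analysis.Convex" "HOL-Library.Discrete_Functions" "HOL-Real_Asymp.Real_Asymp"
begin

text \<open>
  By Cauchy-Schwarz the number of solutions of \<open>b / c = b' / c'\<close> in \<open>A\<close> is at least
  \<open>n\<^sup>4 / |AA|\<close>, so by dyadic pigeonholing there is a set \<open>T\<close> of \<open>M\<close> ratios, each with about
  \<open>t\<close> representations, such that \<open>M t\<^sup>2\<close> is at least \<open>n\<^sup>2\<^sup>+\<^sup>\<beta>\<close> up to logarithms. For
  \<open>a, b, c \<in> A\<close> with \<open>b / c \<in> T\<close> join \<open>\<lambda>ac + b\<close> to \<open>c - \<lambda>ac\<close>, where \<open>\<lambda>\<close> is a generic real.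
  The sum is \<open>b + c \<in> A + A\<close>; the ratio \<open>(\<lambda>a + b/c) / (1 - \<lambda>a)\<close> depends only on \<open>a\<close> and \<open>b/c\<close>,
  so there are at most \<open>2 n M\<close> ratios; the vertices depend only on an element of \<open>AA\<close> and one of
  \<open>A\<close>, so there are at most \<open>N = 2 n |AA|\<close> of them; and genericity makes the about \<open>n M t\<close>
  edges distinct up to orientation. For bounded \<open>n\<close>, which is always the case if \<open>\<beta> \<ge> 3\<close>, a
  single edge suffices.
\<close>

section \<open>Fibres of a map and multiplicative energy\<close>

lemma sum_card_fibre:
  assumes "finite X"
  shows "(\<Sum>y\<in>f ` X. card {x\<in>X. f x = y}) = card X"
  using sum.image_gen[OF assms, of "\<lambda>_. 1::nat" f] by simp

lemma sum_card_fibre_squared: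
  assumes "finite X"
  shows "(\<Sum>y\<in>f ` X. (card {x\<in>X. f x = y})\<^sup>2) = card {(x, x'). x \<in> X \<and> x' \<in> X \<and> f x = f x'}"
proof -
  let ?F = "\<lambda>y. {x\<in>X. f x = y}"
  have "{(x, x'). x \<in> X \<and> x' \<in> X \<and> f x = f x'} = (\<Union>y\<in>f ` X. ?F y \<times> ?F y)"
    by auto
  also have "card \<dots> = (\<Sum>y\<in>f ` X. card (?F y \<times> ?F y))"
    using assms by (intro card_UN_disjoint) auto
  finally show ?thesis by (simp add: card_cartesian_product power2_eq_square)
qed

text \<open>Cauchy-Schwarz over the fibres of the product map bounds \<open>card A ^ 4\<close> by
  \<open>card (A * A)\<close> times the number of solutions of \<open>a * d = b * c\<close>. These
  are also the solutions of \<open>a / b = c / d\<close>, so the energy can be summed over ratios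
  instead of products.\<close>

lemma mult_energy_lower_bound:
  fixes A :: "real set"
  assumes fin: "finite A" and "0 \<notin> A"
  defines "X \<equiv> A \<times> A"
  shows "real (card A) ^ 4 \<le>
    real (card (A * A)) * (\<Sum>q\<in>(\<lambda>(b, c). b / c) ` X. (real (card {x\<in>X. (\<lambda>(b, c). b / c) x = q}))\<^sup>2)"
proof -
  let ?prod = "\<lambda>(a, b). a * b :: real" and ?ratio = "\<lambda>(b, c). b / c :: real"
  have finX: "finite X" using fin by (simp add: X_def)
  have nz: "a \<noteq> 0" if "a \<in> A" for a using that \<open>0 \<notin> A\<close> by auto
  have img: "?prod ` X = A * A"
    by (auto simp: X_def set_times_def image_iff)
  \<comment> \<open>Cross-multiplication, legitimate because \<open>A\<close> omits 0.\<close>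
  have "bij_betw (\<lambda>((a, b), (c, d)). ((a, d), (b, c)))
      {(x, x'). x \<in> X \<and> x' \<in> X \<and> ?ratio x = ?ratio x'}
      {(x, x'). x \<in> X \<and> x' \<in> X \<and> ?prod x = ?prod x'}"
    by (rule bij_betw_byWitness[where f' = "\<lambda>((a, d), (b, c)). ((a, b), (c, d))"])
       (use nz in \<open>auto simp: X_def frac_eq_eq mult.commute\<close>)
  hence "card {(x, x'). x \<in> X \<and> x' \<in> X \<and> ?ratio x = ?ratio x'}
      = card {(x, x'). x \<in> X \<and> x' \<in> X \<and> ?prod x = ?prod x'}"
    by (rule bij_betw_same_card)
  hence energy: "(\<Sum>q\<in>?ratio ` X. (card {x\<in>X. ?ratio x = q})\<^sup>2)
      = (\<Sum>p\<in>?prod ` X. (card {x\<in>X. ?prod x = p})\<^sup>2)"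
    using sum_card_fibre_squared[OF finX] by metis
  have "real (card A) ^ 4 = (real (card X))\<^sup>2"
    by (simp add: X_def card_cartesian_product power4_eq_xxxx power2_eq_square)
  also have "\<dots> = (\<Sum>p\<in>?prod ` X. real (card {x\<in>X. ?prod x = p}))\<^sup>2"
    by (simp only: of_nat_sum[symmetric] sum_card_fibre[OF finX])
  also have "\<dots> \<le> (\<Sum>p\<in>?prod ` X. (real (card {x\<in>X. ?prod x = p}))\<^sup>2) * card (?prod ` X)"
    by (rule sum_squared_le_sum_of_squares)
  also have "(\<Sum>p\<in>?prod ` X. (real (card {x\<in>X. ?prod x = p}))\<^sup>2)
      = (\<Sum>q\<in>?ratio ` X. (real (card {x\<in>X. ?ratio x = q}))\<^sup>2)"
    using arg_cong[OF energy, of real] by simp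
  finally show ?thesis unfolding img by (simp add: mult.commute)
qed

section \<open>Dyadic pigeonholing\<close>

text \<open>The values of \<open>r\<close> fall into at most \<open>Suc (floor_log n)\<close> dyadic
  classes; the class with the largest sum of squares carries at least the average.\<close>

lemma dyadic_pigeonhole:
  fixes r :: "'a \<Rightarrow> nat"
  assumes fin: "finite R" and pos: "\<And>q. q \<in> R \<Longrightarrow> 0 < r q" and bound: "\<And>q. q \<in> R \<Longrightarrow> r q \<le> n"
  obtains T j where "T \<subseteq> R" "\<forall>q\<in>T. 2 ^ j \<le> r q" "\<forall>q\<in>T. r q < 2 ^ Suc j"
    "j \<le> floor_log n"
    "(\<Sum>q\<in>R. (real (r q))\<^sup>2) \<le> real (Suc (floor_log n)) * (\<Sum>q\<in>T. (real (r q))\<^sup>2)"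
proof -
  define T where "T = (\<lambda>j. {q\<in>R. floor_log (r q) = j})"
  define S where "S = (\<lambda>j. \<Sum>q\<in>T j. (real (r q))\<^sup>2)"
  let ?I = "{..floor_log n}"
  have sub: "(\<lambda>q. floor_log (r q)) ` R \<subseteq> ?I"
    using bound by (auto intro: floor_log_le_iff)
  have "(\<Sum>q\<in>R. (real (r q))\<^sup>2) = (\<Sum>j\<in>?I. S j)"
    unfolding S_def T_def by (rule sum.group[symmetric]) (use fin sub in auto)
  moreover have "Max (S ` ?I) \<in> S ` ?I" by (rule Max_in) auto
  then obtain j where j: "j \<in> ?I" "S j = Max (S ` ?I)" by (metis imageE)
  moreover have "(\<Sum>i\<in>?I. S i) \<le> real (card ?I) * S j"
    unfolding j(2) by (intro sum_bounded_above Max_ge) auto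
  ultimately have "(\<Sum>q\<in>R. (real (r q))\<^sup>2) \<le> real (Suc (floor_log n)) * S j" by simp
  \<comment> \<open>Positivity of \<open>r q\<close> matters here: since
    \<open>floor_log 0 = 0\<close>, a zero value would land in class 0 and violate the lower
    bound.\<close>
  moreover have "2 ^ j \<le> r q \<and> r q < 2 ^ Suc j" if "q \<in> T j" for q
    using that pos[of q] floor_log_exp2_le[of "r q"] floor_log_exp2_gt[of "r q"] by (auto simp: T_def)
  ultimately show ?thesis
    using j(1) by (intro that[of "T j" j]) (auto simp: T_def S_def)
qed

text \<open>From \<open>ln 2 \<ge> 1/2\<close> one gets \<open>floor_log n \<le> 2 * ln n\<close>,
  and \<open>n \<ge> 3 \<ge> exp 1\<close> lets \<open>ln n\<close> absorb the extra 1.\<close>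

lemma Suc_floor_log_le_ln:
  assumes "3 \<le> n"
  shows "real (Suc (floor_log n)) \<le> 4 * ln (real n)"
proof -
  have "exp 1 \<le> (3::real)" by (rule exp_le)
  hence 1: "1 \<le> ln (real n)" using assms by (subst ln_ge_iff) auto
  have "(2::real) ^ floor_log n \<le> real n"
    using floor_log_exp2_le[of n] assms by (metis of_nat_le_iff of_nat_numeral of_nat_power less_le_trans zero_less_numeral)
  hence "real (floor_log n) * ln 2 \<le> ln (real n)"
    using assms by (metis ln_le_cancel_iff ln_realpow of_nat_0_less_iff zero_less_numeral zero_less_power less_le_trans)
  moreover have "1/2 \<le> ln (2::real)" using ln_le_minus_one[of "1/2"] by (simp add: ln_div)
  ultimately have "real (floor_log n) * (1/2) \<le> ln (real n)"
    by (smt (verit) mult_left_mono of_nat_0_le_iff)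
  thus ?thesis using 1 by simp
qed

section \<open>The graph twisted by a generic real\<close>

text \<open>Forgetting the orientation identifies only \<open>(u, v)\<close> with
  \<open>(v, u)\<close>, so passing to edges costs at most a factor 2.\<close>

lemma card_unordered_pairs_ge:
  assumes "finite Y"
  shows "card Y \<le> 2 * card ((\<lambda>(x, y). {x, y}) ` Y)"
proof -
  let ?G = "(\<lambda>(x, y). {x, y}) ` Y"
  have fibre: "card {p\<in>Y. (\<lambda>(x, y). {x, y}) p = e} \<le> 2" if "e \<in> ?G" for e
  proof -
    obtain u v where e: "e = {u, v}" using \<open>e \<in> ?G\<close> by auto
    have "{p\<in>Y. (\<lambda>(x, y). {x, y}) p = e} \<subseteq> set [(u, v), (v, u)]"
    proof
      fix p assume "p \<in> {p\<in>Y. (\<lambda>(x, y). {x, y}) p = e}"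
      then obtain x y where "p = (x, y)" "{x, y} = {u, v}" using e by (cases p) simp
      thus "p \<in> set [(u, v), (v, u)]" unfolding doubleton_eq_iff by auto
    qed
    hence "card {p\<in>Y. (\<lambda>(x, y). {x, y}) p = e} \<le> card (set [(u, v), (v, u)])"
      by (rule card_mono[OF finite_set])
    also have "\<dots> \<le> length [(u, v), (v, u)]" by (rule card_length)
    finally show ?thesis by simp
  qed
  have "card Y = (\<Sum>e\<in>?G. card {p\<in>Y. (\<lambda>(x, y). {x, y}) p = e})"
    by (rule sum_card_fibre[OF assms, symmetric])
  also have "\<dots> \<le> of_nat (card ?G) * 2"
    by (rule sum_bounded_above) (rule fibre)
  finally show ?thesis by simp
qed

text \<open>Serves to pad a vertex set with isolated vertices up to a prescribed size.\<close>

lemma obtain_superset_of_card: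
  assumes "infinite (UNIV :: 'a set)" and "finite (V :: 'a set)" and "card V \<le> N"
  obtains B where "V \<subseteq> B" "finite B" "card B = N"
proof -
  have "infinite (- V)" using assms by (simp add: Compl_eq_Diff_UNIV)
  then obtain C where "finite C" "card C = N - card V" "C \<subseteq> - V"
    using infinite_arbitrarily_large by blast
  with assms show ?thesis
    by (intro that[of "V \<union> C"]) (auto simp: card_Un_disjoint disjoint_eq_subset_Compl Int_commute[of V])
qed

text \<open>The construction works for any finite set \<open>T\<close> of ratios. The factors 2 come
  from the two kinds of endpoints, from the loss of orientation, and from the two ratios that each
  edge contributes.\<close>

lemma twisted_graph:
  fixes A T :: "real set"
  assumes fin: "finite A" and zero: "0 \<notin> A" and finT: "finite T"
  obtains G where "simple_graph (\<Union>G) G" "\<forall>e\<in>G. 0 \<notin> e"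
    "card (\<Union>G) \<le> 2 * (card A * card (A * A))"
    "card A * card {x\<in>A \<times> A. (\<lambda>(b, c). b / c) x \<in> T} \<le> 2 * card G"
    "card (graph_ratioset G) \<le> 2 * (card A * card T)"
    "graph_sumset G \<subseteq> A + A"
proof -
  \<comment> \<open>The four families contain the values of \<open>l\<close> for which, in this
    order, the first endpoint vanishes, the second endpoint \<open>c * (1 - l * a)\<close> vanishes,
    the endpoints coincide, or \<open>l * p + b\<close> fails to determine \<open>p\<close>. Zero
    denominators, as for \<open>p = p'\<close>, merely put 0 into \<open>bad\<close>.\<close>
  define bad where "bad = (\<lambda>(a, b, c). - b / (a * c)) ` (A \<times> A \<times> A)
     \<union> (\<lambda>a. 1 / a) ` A
     \<union> (\<lambda>(a, b, c). (c - b) / (2 * a * c)) ` (A \<times> A \<times> A)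
     \<union> (\<lambda>(p, p', b, b'). (b' - b) / (p - p')) ` ((A * A) \<times> (A * A) \<times> A \<times> A)"
  have nz: "a \<noteq> 0" if "a \<in> A" for a using that zero by auto
  have finAA: "finite (A * A)" using fin by (rule finite_set_times) (rule fin)
  have "finite bad" using fin finAA by (simp add: bad_def)
  then obtain l where l: "l \<notin> bad"
    using ex_new_if_finite[OF infinite_UNIV_char_0] by blast
  have l1: "l * (a * c) + b \<noteq> 0" if "a \<in> A" "b \<in> A" "c \<in> A" for a b c
  proof
    assume "l * (a * c) + b = 0"
    hence "l * (a * c) = - b" by linarith
    hence "l = - b / (a * c)" using nz that by (metis mult_eq_0_iff nonzero_mult_div_cancel_right)
    with l that show False unfolding bad_def by force
  qed
  have l2: "1 - l * a \<noteq> 0" if "a \<in> A" for a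
  proof
    assume "1 - l * a = 0"
    hence "l = 1 / a" using nz that by (simp add: field_simps)
    with l that show False unfolding bad_def by force
  qed
  have l3: "l * (a * c) + b \<noteq> c - l * (a * c)" if "a \<in> A" "b \<in> A" "c \<in> A" for a b c
  proof
    assume "l * (a * c) + b = c - l * (a * c)"
    hence "l = (c - b) / (2 * a * c)" using nz that by (simp add: field_simps)
    with l that show False unfolding bad_def by force
  qed
  have l4: "p = p'" if "l * p + b = l * p' + b'" "p \<in> A * A" "p' \<in> A * A" "b \<in> A" "b' \<in> A" for p p' b b'
  proof (rule ccontr)
    assume "p \<noteq> p'"
    hence "l = (b' - b) / (p - p')" using that(1) by (simp add: field_simps)
    with l that show False unfolding bad_def by force
  qed
  define X where "X = {(a, b, c). a \<in> A \<and> b \<in> A \<and> c \<in> A \<and> b / c \<in> T}"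
  define f where "f = (\<lambda>(a, b, c). (l * (a * c) + b, c - l * (a * c)))"
  define G where "G = (\<lambda>(x, y). {x, y}) ` (f ` X)"
  have Xeq: "X = A \<times> {x\<in>A \<times> A. (\<lambda>(b, c). b / c) x \<in> T}"
    by (auto simp: X_def)
  have finX: "finite X" unfolding Xeq using fin by auto
  have G_iff: "e \<in> G \<longleftrightarrow> (\<exists>a\<in>A. \<exists>b\<in>A. \<exists>c\<in>A. b / c \<in> T \<and> e = {l * (a * c) + b, c - l * (a * c)})" for e
    unfolding G_def f_def X_def by (auto simp: image_iff)
  have edge: "\<exists>a\<in>A. \<exists>b\<in>A. \<exists>c\<in>A. b / c \<in> T \<and>
      (x = l * (a * c) + b \<and> y = c - l * (a * c) \<or> y = l * (a * c) + b \<and> x = c - l * (a * c))"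
    if "{x, y} \<in> G" for x y
    using that unfolding G_iff by (metis doubleton_eq_iff)
  have inj: "inj_on f X"
  proof (rule inj_onI)
    fix u v assume uv: "u \<in> X" "v \<in> X" "f u = f v"
    obtain a b c where u: "u = (a, b, c)" by (cases u)
    obtain a' b' c' where v: "v = (a', b', c')" by (cases v)
    have mem: "a \<in> A" "b \<in> A" "c \<in> A" "a' \<in> A" "b' \<in> A" "c' \<in> A"
      using uv by (auto simp: u v X_def)
    have eqs: "l * (a * c) + b = l * (a' * c') + b'" "c - l * (a * c) = c' - l * (a' * c')"
      using uv(3) by (auto simp: f_def u v)
    \<comment> \<open>Genericity recovers the product from the first endpoint alone. Then
      \<open>b\<close> and \<open>c\<close> can be read off the two endpoints, and \<open>a\<close>
      follows by cancelling \<open>c\<close>.\<close>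
    have "a * c = a' * c'"
      using l4[OF eqs(1)] mem by (auto intro: set_times_intro)
    with eqs have "b = b'" "c = c'" by auto
    moreover have "c \<noteq> 0" using mem zero by auto
    ultimately show "u = v" using \<open>a * c = a' * c'\<close> by (simp add: u v)
  qed
  have zero_notin: "0 \<notin> e" if "e \<in> G" for e
  proof -
    obtain a b c where abc: "a \<in> A" "b \<in> A" "c \<in> A" "e = {l * (a * c) + b, c - l * (a * c)}"
      using \<open>e \<in> G\<close> unfolding G_iff by blast
    have "c - l * (a * c) = c * (1 - l * a)" by (simp add: algebra_simps)
    moreover have "c * (1 - l * a) \<noteq> 0" using abc zero l2[of a] by auto
    ultimately show ?thesis using l1[of a b c] abc by auto
  qed
  have finG: "finite G" using finX by (simp add: G_def)
  have two: "card e = 2" if "e \<in> G" for e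
    using that l3 unfolding G_iff by (metis card_2_iff)
  hence finU: "finite (\<Union>G)"
    using finG by (intro finite_Union) (auto intro: card_ge_0_finite)
  have "card (\<Union>G) \<le> 2 * (card A * card (A * A))"
  proof -
    let ?S = "(A * A) \<times> A"
    have "\<Union>G \<subseteq> (\<lambda>(p, b). l * p + b) ` ?S \<union> (\<lambda>(p, c). c - l * p) ` ?S"
    proof
      fix x assume "x \<in> \<Union>G"
      then obtain a b c where abc: "a \<in> A" "b \<in> A" "c \<in> A" "x = l * (a * c) + b \<or> x = c - l * (a * c)"
        unfolding Union_iff Bex_def G_iff by blast
      have "(a * c, b) \<in> ?S" "(a * c, c) \<in> ?S" using abc by (auto intro: set_times_intro)
      thus "x \<in> (\<lambda>(p, b). l * p + b) ` ?S \<union> (\<lambda>(p, c). c - l * p) ` ?S"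
        using abc(4) by force
    qed
    hence "card (\<Union>G) \<le> card ((\<lambda>(p, b). l * p + b) ` ?S \<union> (\<lambda>(p, c). c - l * p) ` ?S)"
      using fin finAA by (intro card_mono) auto
    also have "\<dots> \<le> card ?S + card ?S"
      using fin finAA by (intro order.trans[OF card_Un_le] add_mono card_image_le) auto
    finally show ?thesis by (simp add: card_cartesian_product mult.commute)
  qed
  moreover have "card A * card {x\<in>A \<times> A. (\<lambda>(b, c). b / c) x \<in> T} \<le> 2 * card G"
    using card_unordered_pairs_ge[of "f ` X"] finX card_image[OF inj]
    by (simp add: G_def Xeq card_cartesian_product)
  moreover have "card (graph_ratioset G) \<le> 2 * (card A * card T)"
  proof -
    let ?g = "\<lambda>(a, q). (l * a + q) / (1 - l * a)" and ?h = "\<lambda>(a, q). (1 - l * a) / (l * a + q)"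
    have "graph_ratioset G \<subseteq> ?g ` (A \<times> T) \<union> ?h ` (A \<times> T)"
    proof
      fix z assume "z \<in> graph_ratioset G"
      then obtain x y where xy: "z = x / y" "{x, y} \<in> G" by (auto simp: graph_ratioset_def)
      obtain a b c where abc: "a \<in> A" "b \<in> A" "c \<in> A" "b / c \<in> T"
        "x = l * (a * c) + b \<and> y = c - l * (a * c) \<or> y = l * (a * c) + b \<and> x = c - l * (a * c)"
        using edge[OF xy(2)] by blast
      have "c \<noteq> 0" using abc zero by auto
      hence "l * (a * c) + b = c * (l * a + b / c)" "c - l * (a * c) = c * (1 - l * a)"
        by (simp_all add: algebra_simps)
      hence "z = ?g (a, b / c) \<or> z = ?h (a, b / c)"
        using abc(5) xy(1) \<open>c \<noteq> 0\<close> by auto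
      thus "z \<in> ?g ` (A \<times> T) \<union> ?h ` (A \<times> T)" using abc by blast
    qed
    hence "card (graph_ratioset G) \<le> card (?g ` (A \<times> T) \<union> ?h ` (A \<times> T))"
      using fin finT by (intro card_mono) auto
    also have "\<dots> \<le> card (A \<times> T) + card (A \<times> T)"
      using fin finT by (intro order.trans[OF card_Un_le] add_mono card_image_le) auto
    finally show ?thesis by (simp add: card_cartesian_product)
  qed
  moreover have "graph_sumset G \<subseteq> A + A"
  proof
    fix z assume "z \<in> graph_sumset G"
    then obtain x y where xy: "z = x + y" "{x, y} \<in> G" by (auto simp: graph_sumset_def)
    from edge[OF xy(2)] show "z \<in> A + A"
      unfolding xy(1) by (auto intro: set_plus_intro simp: add.commute)
  qed
  ultimately show ?thesis
    using finU two zero_notin by (intro that[of G]) (auto simp: simple_graph_def)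
qed

section \<open>Popular ratios and the size of the graph\<close>

text \<open>\<open>P\<close> counts the popular ratios and will be the parameter M; \<open>k\<close>
  bounds the number of dyadic classes. The last three estimates become the lower and upper bounds
  for M and the bound for the number of edges.\<close>

lemma popular_ratio_graph:
  fixes A :: "real set"
  assumes fin: "finite A" and n: "card A = n" "3 \<le> n"
  defines "Q \<equiv> real (card (A * A))" and "k \<equiv> 4 * ln (real n)"
  obtains G and P :: nat where "simple_graph (\<Union>G) G" "\<forall>e\<in>G. 0 \<notin> e"
    "card (\<Union>G) \<le> 2 * (n * card (A * A))"
    "card (graph_ratioset G) \<le> 2 * (n * P)"
    "graph_sumset G \<subseteq> A + A"
    "(real n)\<^sup>2 \<le> 64 * (Q * k) * real P"
    "real P \<le> 64 * (Q * k)"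
    "real P * real n ^ 6 \<le> 1024 * (Q * k) * (real (card G))\<^sup>2"
proof -
  \<comment> \<open>Ratios require the removal of 0; as \<open>n \<ge> 3\<close>, at least half of
    \<open>A\<close> survives.\<close>
  define A' where "A' = A - {0}"
  define X where "X = A' \<times> A'"
  define f :: "real \<times> real \<Rightarrow> real" where "f = (\<lambda>(b, c). b / c)"
  define r where "r = (\<lambda>q. card {x\<in>X. f x = q})"
  have A': "finite A'" "0 \<notin> A'" "A' \<subseteq> A" using fin by (auto simp: A'_def)
  have n': "card A' \<le> n" "n \<le> 2 * card A'"
    using n fin by (auto simp: A'_def card_Diff_singleton_if)
  have finX: "finite X" using A' by (simp add: X_def)
  have r_pos: "0 < r q" if "q \<in> f ` X" for q
    using that finX by (auto simp: r_def card_gt_0_iff)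
  have r_le: "r q \<le> n" for q
  proof -
    \<comment> \<open>For a given ratio \<open>q\<close>, the denominator determines the
      numerator.\<close>
    have "inj_on snd {x\<in>X. f x = q}"
      using A'(2) by (auto simp: inj_on_def X_def f_def)
    moreover have "snd ` {x\<in>X. f x = q} \<subseteq> A'" by (auto simp: X_def)
    ultimately have "r q \<le> card A'"
      unfolding r_def by (rule card_inj_on_le) (rule A'(1))
    thus ?thesis using n' by simp
  qed
  obtain T j where T: "T \<subseteq> f ` X" "\<forall>q\<in>T. 2 ^ j \<le> r q" "\<forall>q\<in>T. r q < 2 ^ Suc j"
      "j \<le> floor_log n"
      "(\<Sum>q\<in>f ` X. (real (r q))\<^sup>2) \<le> real (Suc (floor_log n)) * (\<Sum>q\<in>T. (real (r q))\<^sup>2)"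
    using dyadic_pigeonhole[of "f ` X" r n, OF finite_imageI[OF finX] r_pos r_le] .
  define P where "P = card T"
  \<comment> \<open>Every ratio in \<open>T\<close> has between \<open>t\<close> and
    \<open>2 * t\<close> representations; \<open>W\<close> is the total number of these
    representations.\<close>
  define t :: real where "t = 2 ^ j"
  define W where "W = card {x\<in>X. f x \<in> T}"
  have finT: "finite T" using T(1) finX finite_surj by blast
  obtain G where G: "simple_graph (\<Union>G) G" "\<forall>e\<in>G. 0 \<notin> e"
    "card (\<Union>G) \<le> 2 * (card A' * card (A' * A'))" "card A' * W \<le> 2 * card G"
    "card (graph_ratioset G) \<le> 2 * (card A' * P)" "graph_sumset G \<subseteq> A' + A'"
    using twisted_graph[OF A'(1,2) finT] unfolding W_def X_def f_def P_def .
  have finAA: "finite (A * A)" using fin by (rule finite_set_times) (rule fin)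
  have AA: "card (A' * A') \<le> card (A * A)"
    using finAA A'(3) by (intro card_mono set_times_mono2)
  have k: "real (Suc (floor_log n)) \<le> k"
    unfolding k_def using n(2) by (rule Suc_floor_log_le_ln)
  have Qk: "0 \<le> Q * k" using k by (simp add: Q_def)
  have t: "0 < t" "t \<le> real n"
  proof -
    have "(2::nat) ^ j \<le> 2 ^ floor_log n" using T(4) by simp
    also have "\<dots> \<le> n" using n by (intro floor_log_exp2_le) simp
    finally show "t \<le> real n" by (simp add: t_def flip: of_nat_le_iff)
  qed (simp add: t_def)
  have W: "real W = (\<Sum>q\<in>T. real (r q))"
  proof -
    have fib: "{x \<in> {x\<in>X. f x \<in> T}. f x = q} = {x\<in>X. f x = q}" if "q \<in> T" for q using that by auto
    have "f ` {x\<in>X. f x \<in> T} = T" using T(1) by auto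
    with sum_card_fibre[of "{x\<in>X. f x \<in> T}" f] finX
    have "W = (\<Sum>q\<in>T. card {x \<in> {x\<in>X. f x \<in> T}. f x = q})" by (simp add: W_def)
    also have "\<dots> = (\<Sum>q\<in>T. r q)" using fib by (intro sum.cong) (auto simp: r_def)
    finally show ?thesis by simp
  qed
  have Pt_le_W: "real P * t \<le> real W"
  proof -
    have "t \<le> real (r q)" if "q \<in> T" for q
      using bspec[OF T(2) that] by (simp add: t_def flip: of_nat_le_iff)
    thus ?thesis unfolding W P_def by (rule sum_bounded_below)
  qed
  have W_le: "real W \<le> (real n)\<^sup>2"
  proof -
    have "W \<le> card X" unfolding W_def using finX by (intro card_mono) auto
    also have "\<dots> \<le> n * n" using n' by (simp add: X_def card_cartesian_product mult_mono)
    finally show ?thesis by (simp add: power2_eq_square flip: of_nat_mult of_nat_le_iff)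
  qed
  have squares: "(\<Sum>q\<in>T. (real (r q))\<^sup>2) \<le> real P * (2 * t)\<^sup>2"
    unfolding P_def
  proof (rule sum_bounded_above)
    fix q assume "q \<in> T"
    have "r q \<le> 2 * 2 ^ j" using bspec[OF T(3) \<open>q \<in> T\<close>] by simp
    hence "real (r q) \<le> real (2 * 2 ^ j)" by (simp only: of_nat_le_iff)
    hence "real (r q) \<le> 2 * t" by (simp add: t_def)
    thus "(real (r q))\<^sup>2 \<le> (2 * t)\<^sup>2" by (intro power_mono) auto
  qed
  \<comment> \<open>The constant is \<open>2 ^ 4 * 2 ^ 2\<close>: the first factor pays for removing
    0, the second for replacing \<open>r q\<close> by \<open>2 * t\<close>.\<close>
  have key: "real n ^ 4 \<le> 64 * (Q * k) * (real P * t\<^sup>2)"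
  proof -
    have "real n ^ 4 \<le> (2 * real (card A')) ^ 4" using n' by (intro power_mono) auto
    also have "\<dots> = 16 * real (card A') ^ 4" by (simp add: power_mult_distrib)
    also have "\<dots> \<le> 16 * (real (card (A' * A')) * (\<Sum>q\<in>f ` X. (real (r q))\<^sup>2))"
      using mult_energy_lower_bound[OF A'(1,2)] by (simp add: X_def f_def r_def)
    also have "\<dots> \<le> 16 * (Q * (k * (real P * (2 * t)\<^sup>2)))"
    proof -
      have "(\<Sum>q\<in>f ` X. (real (r q))\<^sup>2) \<le> k * (real P * (2 * t)\<^sup>2)"
        using T(5) k squares by (smt (verit) mult_mono of_nat_0_le_iff sum_nonneg zero_le_power2)
      thus ?thesis using AA by (intro mult_left_mono mult_mono) (auto simp: Q_def intro: sum_nonneg)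
    qed
    finally show ?thesis by (simp add: power_mult_distrib mult_ac)
  qed
  have n0: "real n > 0" using n by simp
  have 1: "(real n)\<^sup>2 \<le> 64 * (Q * k) * real P"
  proof -
    have "real n ^ 4 \<le> 64 * (Q * k) * (real P * (real n)\<^sup>2)"
      using t Qk by (intro order.trans[OF key] mult_left_mono power_mono) auto
    hence "(real n)\<^sup>2 * (real n)\<^sup>2 \<le> (64 * (Q * k) * real P) * (real n)\<^sup>2"
      by (simp add: power4_eq_xxxx power2_eq_square mult_ac)
    thus ?thesis using n0 by (simp only: mult_le_cancel_right) auto
  qed
  \<comment> \<open>Multiplying \<open>key\<close> by \<open>P\<close> completes the square
    \<open>(P * t)\<^sup>2\<close>, which is at most \<open>W\<^sup>2\<close>. This eliminates
    \<open>t\<close>.\<close>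
  have key2: "real P * real n ^ 4 \<le> 64 * (Q * k) * (real W)\<^sup>2"
  proof -
    have "real P * real n ^ 4 \<le> real P * (64 * (Q * k) * (real P * t\<^sup>2))"
      using key by (intro mult_left_mono) auto
    also have "\<dots> = 64 * (Q * k) * (real P * t)\<^sup>2" by (simp add: power2_eq_square mult_ac)
    also have "\<dots> \<le> 64 * (Q * k) * (real W)\<^sup>2"
      using Pt_le_W Qk t by (intro mult_left_mono power_mono) auto
    finally show ?thesis .
  qed
  have 2: "real P \<le> 64 * (Q * k)"
  proof -
    have "(real W)\<^sup>2 \<le> ((real n)\<^sup>2)\<^sup>2" using W_le by (intro power_mono) auto
    hence "real P * real n ^ 4 \<le> 64 * (Q * k) * real n ^ 4"
      using Qk by (intro order.trans[OF key2] mult_left_mono) (auto simp flip: power_mult)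
    thus ?thesis using n0 by (simp only: mult_le_cancel_right) auto
  qed
  have 3: "real P * real n ^ 6 \<le> 1024 * (Q * k) * (real (card G))\<^sup>2"
  proof -
    \<comment> \<open>One factor 2 pays for \<open>A'\<close> in place of \<open>A\<close>, the
      other for orientation; squared, they turn 64 into 1024.\<close>
    have "n * W \<le> 2 * card A' * W" using n'(2) by (rule mult_le_mono1)
    also have "\<dots> \<le> 4 * card G" using G(4) by (simp add: mult.commute)
    finally have "real n * real W \<le> 4 * real (card G)"
      by (simp flip: of_nat_mult of_nat_le_iff)
    hence nW: "(real n * real W)\<^sup>2 \<le> (4 * real (card G))\<^sup>2" by (intro power_mono) auto
    have "real P * real n ^ 6 = (real P * real n ^ 4) * (real n)\<^sup>2"
      by (simp add: mult.assoc flip: power_add)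
    also have "\<dots> \<le> 64 * (Q * k) * (real W)\<^sup>2 * (real n)\<^sup>2"
      using key2 by (intro mult_right_mono) auto
    also have "\<dots> = 64 * (Q * k) * (real n * real W)\<^sup>2" by (simp add: power_mult_distrib)
    also have "\<dots> \<le> 64 * (Q * k) * (4 * real (card G))\<^sup>2"
      using nW Qk by (intro mult_left_mono) auto
    finally show ?thesis by (simp add: power_mult_distrib)
  qed
  show ?thesis
  proof (rule that[OF G(1,2) _ _ _ 1 2 3])
    show "card (\<Union>G) \<le> 2 * (n * card (A * A))"
      using G(3) n' AA by (meson le_trans mult_le_mono mult_le_mono2)
    show "card (graph_ratioset G) \<le> 2 * (n * P)"
      using G(5) n' by (meson le_trans mult_le_mono1 mult_le_mono2)
    show "graph_sumset G \<subseteq> A + A"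
      using G(6) set_plus_mono2[OF A'(3) A'(3)] by blast
  qed
qed

section \<open>Powers of comparable quantities\<close>

text \<open>The sign of \<open>e\<close> decides which of the two comparisons is used. The intended
  pair is N and \<open>n powr (3 - \<beta>)\<close>, which agree up to a power of log N.\<close>

lemma powr_le_powr_of_comparable:
  fixes x y L :: real
  assumes "0 < x" "0 < y" "1 \<le> L" "x \<le> L * y" "y \<le> L * x" "\<bar>e\<bar> \<le> g"
  shows "x powr e \<le> L powr g * y powr e"
proof -
  have "x powr e \<le> L powr \<bar>e\<bar> * y powr e"
  proof (cases "0 \<le> e")
    case True
    hence "x powr e \<le> (L * y) powr e" using assms by (intro powr_mono2) auto
    thus ?thesis using True assms by (simp add: powr_mult)
  next
    case False
    have "x powr e \<le> (y / L) powr e" using assms False by (intro powr_mono2') (auto simp: field_simps)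
    also have "\<dots> = L powr \<bar>e\<bar> * y powr e" using assms False by (simp add: powr_divide powr_minus field_simps)
    finally show ?thesis .
  qed
  also have "\<dots> \<le> L powr g * y powr e" using assms by (intro mult_right_mono powr_mono) auto
  finally show ?thesis .
qed

section \<open>The conclusion for a single cardinality\<close>

text \<open>This is the conclusion of the theorem for given constants. It mentions \<open>n\<close>
  but not \<open>A\<close>, so bounded \<open>n\<close> can be served by a graph unrelated to
  \<open>A\<close>.\<close>

definition admits_model :: "real \<Rightarrow> real \<Rightarrow> real \<Rightarrow> real \<Rightarrow> nat \<Rightarrow> bool" where
  "admits_model \<alpha> \<beta> c E n \<longleftrightarrow> (\<exists>(B :: real set) (N :: nat) (M :: real) (G :: real set set).
          finite B \<and> card B = N \<and> N > n \<and>
          c * log_pow (real N) (- E) * real N powr (\<beta> / (3 - \<beta>)) \<le> M \<and>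
          M \<le> inverse c * log_pow (real N) E * real N powr ((2 - \<beta>) / (3 - \<beta>)) \<and>
          simple_graph B G \<and> (\<forall>e\<in>G. 0 \<notin> e) \<and>
          real (card G) \<ge>
            c * log_pow (real N) (- E) * M powr (1/2) * real N powr ((4 + \<beta>) / (6 - 2 * \<beta>)) \<and>
          real (card (graph_ratioset G)) \<le>
            inverse c * log_pow (real N) E * M * real N powr (1 / (3 - \<beta>)) \<and>
          real (card (graph_sumset G)) \<le>
            inverse c * log_pow (real N) E * real N powr ((2 - \<alpha>) / (3 - \<beta>)))"

lemma log_pow_nonneg [simp]: "0 \<le> log_pow x d"
  by (simp add: log_pow_def)

lemma log_pow_eq_powr: "1 < x \<Longrightarrow> log_pow x d = ln x powr d"
  by (simp add: log_pow_def)

text \<open>Lower bounds carry the factor \<open>c\<close> and upper bounds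
  \<open>inverse c\<close>, each times a nonnegative quantity, so shrinking \<open>c\<close> weakens
  all of them. This allows constants from different cases to be merged.\<close>

lemma admits_model_mono:
  assumes "admits_model \<alpha> \<beta> c E n" and "0 < c'" "c' \<le> c"
  shows "admits_model \<alpha> \<beta> c' E n"
proof -
  have 1: "c' * x \<le> y" if "c * x \<le> y" "0 \<le> x" for x y
    using that assms(3) mult_right_mono order_trans by blast
  have inv: "inverse c \<le> inverse c'" using assms by (intro le_imp_inverse_le)
  have 2: "y \<le> inverse c' * x" if "y \<le> inverse c * x" "0 \<le> x" for x y
    using that inv mult_right_mono order_trans by blast
  obtain B N M G where *: "finite B" "card B = N" "N > n"
          "c * (log_pow (real N) (- E) * real N powr (\<beta> / (3 - \<beta>))) \<le> M"
          "M \<le> inverse c * (log_pow (real N) E * real N powr ((2 - \<beta>) / (3 - \<beta>)))"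
          "simple_graph B G" "\<forall>e\<in>G. 0 \<notin> e"
          "c * (log_pow (real N) (- E) * M powr (1/2) * real N powr ((4 + \<beta>) / (6 - 2 * \<beta>))) \<le> real (card G)"
          "real (card (graph_ratioset G)) \<le>
            inverse c * (log_pow (real N) E * M * real N powr (1 / (3 - \<beta>)))"
          "real (card (graph_sumset G)) \<le>
            inverse c * (log_pow (real N) E * real N powr ((2 - \<alpha>) / (3 - \<beta>)))"
    using assms(1) unfolding admits_model_def mult.assoc by blast
  \<comment> \<open>\<open>M\<close> is a factor in the bound for the ratios, so its sign is needed;
    it follows from the lower bound for \<open>M\<close>.\<close>
  have "0 \<le> c * (log_pow (real N) (- E) * real N powr (\<beta> / (3 - \<beta>)))"
    using assms by simp
  hence "0 \<le> M" using *(4) by linarith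
  show ?thesis
    unfolding admits_model_def
    by (rule exI[of _ B], rule exI[of _ N], rule exI[of _ M], rule exI[of _ G])
       (use * \<open>0 \<le> M\<close> 1[OF *(4)] 2[OF *(5)] 1[OF *(8)] 2[OF *(9)] 2[OF *(10)] in \<open>simp add: mult.assoc\<close>)
qed

section \<open>Bounded cardinalities\<close>

text \<open>The single edge \<open>{1, 2}\<close> with M = 1 and one fixed \<open>N\<close> serves
  all \<open>n \<le> n0\<close>. All powers and logarithms are then positive constants, which a
  small \<open>c\<close> absorbs whatever the exponents are.\<close>

lemma bounded_admits_model:
  obtains c where "0 < c" "\<And>n. n \<le> n0 \<Longrightarrow> admits_model \<alpha> \<beta> c E n"
proof -
  \<comment> \<open>The summand 2 gives \<open>N > n0\<close>, room for both endpoints, and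
    \<open>ln N > 0\<close>.\<close>
  define N where "N = n0 + 2"
  obtain B :: "real set" where B: "{1, 2} \<subseteq> B" "finite B" "card B = N"
    using obtain_superset_of_card[OF infinite_UNIV_char_0, of "{1, 2::real}" N] by (auto simp: N_def)
  define G where "G = {{1, 2::real}}"
  have N: "1 < real N" by (simp add: N_def)
  have "graph_ratioset G \<subseteq> set [1/2, 2]"
    by (auto simp: graph_ratioset_def G_def doubleton_eq_iff)
  hence "card (graph_ratioset G) \<le> card (set [1/2, 2::real])"
    by (rule card_mono[OF finite_set])
  hence ratios: "card (graph_ratioset G) \<le> 2" by simp
  have "graph_sumset G \<subseteq> {3}"
    by (auto simp: graph_sumset_def G_def doubleton_eq_iff)
  hence "card (graph_sumset G) \<le> card {3::real}" by (rule card_mono[rotated]) simp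
  hence sums: "card (graph_sumset G) \<le> 1" by simp
  define X where "X = (\<lambda>d e. log_pow (real N) d * real N powr e)"
  have X: "0 < X d e" for d e using N by (simp add: X_def log_pow_eq_powr)
  \<comment> \<open>One entry for each required inequality; the halved one accounts for the two
    ratios 1/2 and 2.\<close>
  define c where "c = Min {1 / X (- E) (\<beta> / (3 - \<beta>)), X E ((2 - \<beta>) / (3 - \<beta>)),
      1 / X (- E) ((4 + \<beta>) / (6 - 2 * \<beta>)), X E (1 / (3 - \<beta>)) / 2, X E ((2 - \<alpha>) / (3 - \<beta>))}"
  have "0 < c" using X by (simp add: c_def)
  have c: "c \<le> 1 / X (- E) (\<beta> / (3 - \<beta>))" "c \<le> X E ((2 - \<beta>) / (3 - \<beta>))"
      "c \<le> 1 / X (- E) ((4 + \<beta>) / (6 - 2 * \<beta>))" "c \<le> X E (1 / (3 - \<beta>)) / 2"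
      "c \<le> X E ((2 - \<alpha>) / (3 - \<beta>))"
    unfolding c_def by (rule Min_le; simp)+
  have "c * X (- E) (\<beta> / (3 - \<beta>)) \<le> 1" "1 \<le> inverse c * X E ((2 - \<beta>) / (3 - \<beta>))"
      "c * X (- E) ((4 + \<beta>) / (6 - 2 * \<beta>)) \<le> 1" "2 \<le> inverse c * X E (1 / (3 - \<beta>))"
      "1 \<le> inverse c * X E ((2 - \<alpha>) / (3 - \<beta>))"
    using c X \<open>0 < c\<close> by (simp_all add: field_simps)
  note ineqs = this[unfolded X_def mult.assoc[symmetric]]
  have "admits_model \<alpha> \<beta> c E n" if "n \<le> n0" for n
    unfolding admits_model_def
  proof (intro exI conjI)
    show "finite B" "card B = N" by fact+
    show "n < N" using that by (simp add: N_def)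
    show "simple_graph B G" using B by (simp add: simple_graph_def G_def)
    show "\<forall>e\<in>G. 0 \<notin> e" by (simp add: G_def)
    show "c * log_pow (real N) (- E) * real N powr (\<beta> / (3 - \<beta>)) \<le> 1" by (rule ineqs)
    show "1 \<le> inverse c * log_pow (real N) E * real N powr ((2 - \<beta>) / (3 - \<beta>))" by (rule ineqs)
    show "c * log_pow (real N) (- E) * 1 powr (1/2) * real N powr ((4 + \<beta>) / (6 - 2 * \<beta>)) \<le> real (card G)"
      using ineqs(3) by (simp add: G_def)
    show "real (card (graph_ratioset G)) \<le> inverse c * log_pow (real N) E * 1 * real N powr (1 / (3 - \<beta>))"
      using ineqs(4) ratios by simp
    show "real (card (graph_sumset G)) \<le> inverse c * log_pow (real N) E * real N powr ((2 - \<alpha>) / (3 - \<beta>))"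
      using ineqs(5) sums by simp
  qed
  with \<open>0 < c\<close> show ?thesis by (rule that)
qed

section \<open>Large cardinalities: passing from n to N\<close>

text \<open>With N = 2n|AA|, the hypotheses on |AA| make N comparable to
  \<open>n powr (3 - \<beta>)\<close> up to logarithms. The estimates in terms of \<open>n\<close>
  thus translate into powers of N.\<close>

lemma large_admits_model:
  fixes \<alpha> \<beta> D :: real
  assumes "\<beta> < 3" "0 \<le> D"
  obtains c E where "0 < c" "0 \<le> E"
    "\<And>(A :: real set) n. \<lbrakk>finite A; card A = n; 3 \<le> n; real (card (A + A)) \<le> real n powr (2 - \<alpha>);
       log_pow (real n) (- D) * real n powr (2 - \<beta>) \<le> real (card (A * A));
       real (card (A * A)) \<le> log_pow (real n) D * real n powr (2 - \<beta>)\<rbrakk> \<Longrightarrow> admits_model \<alpha> \<beta> c E n"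
proof -
  define \<delta> where "\<delta> = 3 - \<beta>"
  have \<delta>: "0 < \<delta>" using assms by (simp add: \<delta>_def)
  \<comment> \<open>A common bound for the absolute values of all exponents of N that occur.\<close>
  define \<gamma> where "\<gamma> = \<bar>\<beta> / \<delta>\<bar> + \<bar>(2 - \<beta>) / \<delta>\<bar> + \<bar>(2 + \<beta> / 2) / \<delta>\<bar> + \<bar>1 / \<delta>\<bar> + \<bar>(2 - \<alpha>) / \<delta>\<bar>"
  \<comment> \<open>\<open>c\<close> and \<open>E\<close> are chosen so that
    \<open>inverse c * (ln N) powr E\<close> equals \<open>H * Z\<close> below: \<open>H\<close>
    absorbs the energy estimate, \<open>Z\<close> the conversion between \<open>n\<close> and
    N.\<close>
  define c :: real where "c = 1 / (256 * 2 powr \<gamma>)"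
  define E where "E = D + 1 + D * \<gamma>"
  have "0 \<le> \<gamma>" by (simp add: \<gamma>_def)
  hence "0 \<le> E" using assms by (simp add: E_def)
  have "admits_model \<alpha> \<beta> c E n"
    if fin: "finite A" and n: "card A = n" "3 \<le> n" and sums: "real (card (A + A)) \<le> real n powr (2 - \<alpha>)"
      and lo: "log_pow (real n) (- D) * real n powr (2 - \<beta>) \<le> real (card (A * A))"
      and hi: "real (card (A * A)) \<le> log_pow (real n) D * real n powr (2 - \<beta>)" for A :: "real set" and n
  proof -
    define Q where "Q = card (A * A)"
    define N where "N = 2 * (n * Q)"
    have "exp 1 \<le> (3::real)" by (rule exp_le)
    hence ln1: "1 \<le> ln (real n)" using n by (subst ln_ge_iff) auto
    obtain G and P :: nat where G: "simple_graph (\<Union>G) G" "\<forall>e\<in>G. 0 \<notin> e" "card (\<Union>G) \<le> N"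
        "card (graph_ratioset G) \<le> 2 * (n * P)" "graph_sumset G \<subseteq> A + A"
        "(real n)\<^sup>2 \<le> 64 * (real Q * (4 * ln (real n))) * real P"
        "real P \<le> 64 * (real Q * (4 * ln (real n)))"
        "real P * real n ^ 6 \<le> 1024 * (real Q * (4 * ln (real n))) * (real (card G))\<^sup>2"
      using popular_ratio_graph[OF fin n] unfolding N_def Q_def by metis
    have n0: "0 < real n" and n1: "1 < real n" using n by auto
    have "0 < real Q"
      using lo n1 ln1 unfolding Q_def log_pow_eq_powr[OF n1]
      by (intro less_le_trans[OF _ lo[unfolded log_pow_eq_powr[OF n1]]]) auto
    hence "1 \<le> Q" by simp
    have "n \<le> n * Q" using \<open>1 \<le> Q\<close> by simp
    hence nN: "n < N" using n unfolding N_def by linarith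
    \<comment> \<open>The bounds to be proved involve log N, which dominates log n because
      \<open>N > n\<close>.\<close>
    define l where "l = ln (real N)"
    have l: "ln (real n) \<le> l" "1 \<le> l" using nN n0 ln1 by (auto simp: l_def intro: order_trans[OF ln1])
    define L where "L = 2 * l powr D"
    have lD: "1 \<le> l powr D" using l assms by (simp add: ge_one_powr_ge_zero)
    hence L: "1 \<le> L" by (simp add: L_def)
    have lnD: "ln (real n) powr D \<le> l powr D" using l ln1 assms by (intro powr_mono2) auto
    have Qhi: "real Q \<le> l powr D * real n powr (2 - \<beta>)"
      using hi lnD unfolding Q_def log_pow_eq_powr[OF n1]
      by (meson mult_right_mono order_trans powr_ge_zero)
    have Qlo: "real n powr (2 - \<beta>) \<le> l powr D * real Q"
    proof -
      have "real n powr (2 - \<beta>) \<le> ln (real n) powr D * real Q"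
        using lo ln1 unfolding Q_def log_pow_eq_powr[OF n1] by (simp add: powr_minus field_simps)
      thus ?thesis using lnD by (meson mult_right_mono order_trans of_nat_0_le_iff)
    qed
    have n\<delta>: "real n powr \<delta> = real n * real n powr (2 - \<beta>)"
      using n0 powr_add[of "real n" 1 "2 - \<beta>"] by (simp add: \<delta>_def)
    have cmp1: "real N \<le> L * real n powr \<delta>"
      using mult_left_mono[OF Qhi, of "2 * real n"] by (simp add: N_def L_def n\<delta> mult_ac)
    have cmp2: "real n powr \<delta> \<le> L * real N"
    proof -
      have "real n powr \<delta> \<le> real n * (l powr D * real Q)"
        using Qlo unfolding n\<delta> by (intro mult_left_mono) auto
      also have "\<dots> \<le> 4 * (real n * (l powr D * real Q))" by simp
      finally show ?thesis by (simp add: N_def L_def mult_ac)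
    qed
    define Z where "Z = L powr \<gamma>"
    have N0: "0 < real N" "1 < real N" using nN n by auto
    have up: "real N powr (e / \<delta>) \<le> Z * real n powr e"
      and down: "real n powr e \<le> Z * real N powr (e / \<delta>)" if "\<bar>e / \<delta>\<bar> \<le> \<gamma>" for e
    proof -
      have eq: "(real n powr \<delta>) powr (e / \<delta>) = real n powr e" using \<delta> by (simp add: powr_powr)
      show "real N powr (e / \<delta>) \<le> Z * real n powr e"
        using powr_le_powr_of_comparable[OF N0(1) _ L cmp1 cmp2 that] n0 unfolding eq Z_def by simp
      show "real n powr e \<le> Z * real N powr (e / \<delta>)"
        using powr_le_powr_of_comparable[OF _ N0(1) L cmp2 cmp1 that] n0 unfolding eq Z_def by simp
    qed
    have \<gamma>s: "\<bar>\<beta> / \<delta>\<bar> \<le> \<gamma>" "\<bar>(2 - \<beta>) / \<delta>\<bar> \<le> \<gamma>" "\<bar>(2 + \<beta> / 2) / \<delta>\<bar> \<le> \<gamma>" "\<bar>1 / \<delta>\<bar> \<le> \<gamma>" "\<bar>(2 - \<alpha>) / \<delta>\<bar> \<le> \<gamma>"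
      unfolding \<gamma>_def by auto
    \<comment> \<open>Here 256 is 64 times the 4 in the bound for the number of dyadic
      classes.\<close>
    define H where "H = 256 * (l powr D * l)"
    have H: "256 \<le> H" using mult_mono[OF lD l(2)] by (simp add: H_def)
    have Z: "1 \<le> Z" using L \<open>0 \<le> \<gamma>\<close> by (simp add: Z_def ge_one_powr_ge_zero)
    have K: "256 * 2 powr \<gamma> * l powr E = H * Z"
      using l by (simp add: H_def Z_def L_def E_def powr_mult powr_add powr_powr)
    have K1: "inverse c * log_pow (real N) E = H * Z"
      using K N0 by (simp add: c_def log_pow_eq_powr l_def)
    have K2: "c * log_pow (real N) (- E) = inverse (H * Z)"
      using N0 unfolding K[symmetric] by (simp add: c_def log_pow_eq_powr l_def powr_minus field_simps)
    have HZ: "0 < H" "0 < Z" "0 < H * Z" using H Z by auto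
    have Qk: "64 * (real Q * (4 * ln (real n))) \<le> H * real n powr (2 - \<beta>)"
    proof -
      have "real Q * ln (real n) \<le> (l powr D * real n powr (2 - \<beta>)) * l"
        using Qhi l ln1 by (intro mult_mono) auto
      thus ?thesis by (simp add: H_def mult_ac)
    qed
    have n_pow: "real n powr \<beta> * real n powr (2 - \<beta>) = (real n)\<^sup>2"
      using n0 by (simp add: powr_add[symmetric])
    have low: "real n powr \<beta> \<le> H * real P"
    proof -
      have "real n powr \<beta> * real n powr (2 - \<beta>) \<le> (H * real n powr (2 - \<beta>)) * real P"
        unfolding n_pow using Qk by (intro order_trans[OF G(6)] mult_right_mono) auto
      also have "\<dots> = (H * real P) * real n powr (2 - \<beta>)" by simp
      finally show ?thesis using n0 by (simp only: mult_le_cancel_right) auto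
    qed
    \<comment> \<open>Both sides are squared. Writing \<open>n ^ 6\<close> as
      \<open>n powr (4 + \<beta>) * n powr (2 - \<beta>)\<close> lets the second factor cancel
      against the bound for |AA|, and \<open>16 \<le> H\<close> absorbs the remaining
      constant.\<close>
    have edges: "real P powr (1/2) * real n powr (2 + \<beta> / 2) \<le> H * real (card G)"
    proof (rule power2_le_imp_le)
      have n6: "real n ^ 6 = real n powr (4 + \<beta>) * real n powr (2 - \<beta>)"
        using n0 by (simp add: powr_add[symmetric])
      have "(real P * real n powr (4 + \<beta>)) * real n powr (2 - \<beta>)
          \<le> 16 * (64 * (real Q * (4 * ln (real n)))) * (real (card G))\<^sup>2"
        using G(8) by (simp add: n6 mult_ac)
      also have "\<dots> \<le> 16 * (H * real n powr (2 - \<beta>)) * (real (card G))\<^sup>2"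
        using Qk by (intro mult_right_mono mult_left_mono) auto
      also have "\<dots> = (16 * H * (real (card G))\<^sup>2) * real n powr (2 - \<beta>)" by simp
      finally have "real P * real n powr (4 + \<beta>) \<le> 16 * H * (real (card G))\<^sup>2"
        using n0 by (simp only: mult_le_cancel_right) auto
      also have "\<dots> \<le> H * H * (real (card G))\<^sup>2" using H by (intro mult_right_mono) auto
      finally have "real P * real n powr (4 + \<beta>) \<le> (H * real (card G))\<^sup>2"
        by (simp add: power2_eq_square mult_ac)
      moreover have "(real P powr (1/2) * real n powr (2 + \<beta> / 2))\<^sup>2 = real P * real n powr (4 + \<beta>)"
      proof -
        have "(real n powr (2 + \<beta> / 2))\<^sup>2 = real n powr (4 + \<beta>)"
          by (simp add: power2_eq_square powr_add[symmetric])
        thus ?thesis by (simp add: power_mult_distrib powr_half_sqrt)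
      qed
      ultimately show "(real P powr (1/2) * real n powr (2 + \<beta> / 2))\<^sup>2 \<le> (H * real (card G))\<^sup>2" by simp
    qed (use H in auto)
    have finG: "finite (\<Union>G)" using G(1) by (simp add: simple_graph_def)
    \<comment> \<open>Isolated vertices bring the vertex set to exactly \<open>N\<close> elements
      without affecting the edges.\<close>
    obtain B where B: "\<Union>G \<subseteq> B" "finite B" "card B = N"
      using obtain_superset_of_card[OF infinite_UNIV_char_0 finG G(3)] .
    have finAA: "finite (A + A)" using fin by (rule finite_set_plus) (rule fin)
    have exponent: "(4 + \<beta>) / (6 - 2 * \<beta>) = (2 + \<beta> / 2) / \<delta>"
      using \<delta> by (simp add: \<delta>_def field_simps)
    show ?thesis
      unfolding admits_model_def exponent \<delta>_def[symmetric]
    proof (rule exI[of _ B], rule exI[of _ N], rule exI[of _ "real P"], rule exI[of _ G],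
        unfold K1 K2, intro conjI)
      show "finite B" "card B = N" "n < N" "\<forall>e\<in>G. 0 \<notin> e" by fact+
      show "simple_graph B G" using G(1) B unfolding simple_graph_def by blast
      have "real N powr (\<beta> / \<delta>) \<le> Z * (H * real P)"
        using up[OF \<gamma>s(1)] low HZ by (meson less_imp_le mult_left_mono order_trans)
      thus "inverse (H * Z) * real N powr (\<beta> / \<delta>) \<le> real P"
        using HZ by (simp add: field_simps)
      have "real P \<le> H * (Z * real N powr ((2 - \<beta>) / \<delta>))"
        using G(7) Qk down[OF \<gamma>s(2)] HZ by (meson less_imp_le mult_left_mono order_trans)
      thus "real P \<le> H * Z * real N powr ((2 - \<beta>) / \<delta>)" by (simp add: mult.assoc)
      have "real P powr (1/2) * real N powr ((2 + \<beta> / 2) / \<delta>)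
          \<le> real P powr (1/2) * (Z * real n powr (2 + \<beta> / 2))"
        using up[OF \<gamma>s(3)] by (intro mult_left_mono) auto
      also have "\<dots> = Z * (real P powr (1/2) * real n powr (2 + \<beta> / 2))" by simp
      also have "\<dots> \<le> Z * (H * real (card G))" using edges HZ by (intro mult_left_mono) auto
      finally show "inverse (H * Z) * real P powr (1/2) * real N powr ((2 + \<beta> / 2) / \<delta>) \<le> real (card G)"
        using HZ by (simp add: field_simps)
      have "real (card (graph_ratioset G)) \<le> 2 * (real n * real P)"
        using G(4) by (metis of_nat_le_iff of_nat_mult of_nat_numeral)
      also have "\<dots> \<le> H * ((Z * real N powr (1 / \<delta>)) * real P)"
        using down[OF \<gamma>s(4)] H n0 by (intro mult_mono) auto
      finally show "real (card (graph_ratioset G)) \<le> H * Z * real P * real N powr (1 / \<delta>)"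
        by (simp add: mult_ac)
      have "real (card (graph_sumset G)) \<le> real (card (A + A))"
        using card_mono[OF finAA G(5)] by simp
      also have "\<dots> \<le> 1 * (Z * real N powr ((2 - \<alpha>) / \<delta>))"
        using sums down[OF \<gamma>s(5)] by simp
      also have "\<dots> \<le> H * (Z * real N powr ((2 - \<alpha>) / \<delta>))"
        using H HZ by (intro mult_right_mono) auto
      finally show "real (card (graph_sumset G)) \<le> H * Z * real N powr ((2 - \<alpha>) / \<delta>)"
        by (simp add: mult.assoc)
    qed
  qed
  moreover have "0 < c" by (simp add: c_def)
  ultimately show ?thesis using \<open>0 \<le> E\<close> that by blast
qed

section \<open>The range \<beta> \<ge> 3\<close>

text \<open>A nonempty \<open>A\<close> has at least one product, whereas the upper bound for |AA|
  is at most (log n)^D / n for \<open>n > 1\<close>, which tends to 0.\<close>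

lemma card_bounded_if_exponent_ge_3:
  fixes \<beta> D :: real
  assumes "3 \<le> \<beta>"
  obtains n0 where "\<And>(A :: real set) n. \<lbrakk>finite A; card A = n;
      real (card (A * A)) \<le> log_pow (real n) D * real n powr (2 - \<beta>)\<rbrakk> \<Longrightarrow> n \<le> n0"
proof -
  have "((\<lambda>n. ln (real n) powr D * real n powr (-1)) \<longlongrightarrow> 0) sequentially"
    by real_asymp
  hence "eventually (\<lambda>n. ln (real n) powr D * real n powr (-1) < 1) sequentially"
    by (rule order_tendstoD) simp
  then obtain n1 where n1: "\<And>n. n1 \<le> n \<Longrightarrow> ln (real n) powr D * real n powr (-1) < 1"
    by (auto simp: eventually_sequentially)
  have "n \<le> n1 + 2" if A: "finite A" "card A = n"
    "real (card (A * A)) \<le> log_pow (real n) D * real n powr (2 - \<beta>)" for A :: "real set" and n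
  proof (rule ccontr)
    assume "\<not> n \<le> n1 + 2"
    hence n: "n1 \<le> n" "1 < real n" by auto
    then obtain a where "a \<in> A" using A(2) by (metis card.empty equals0I not_one_less_zero of_nat_0)
    hence "a * a \<in> A * A" by (intro set_times_intro)
    moreover have "finite (A * A)" using A(1) by (rule finite_set_times) (rule A(1))
    ultimately have "1 \<le> real (card (A * A))"
      by (metis One_nat_def Suc_leI card_gt_0_iff empty_iff of_nat_1 of_nat_mono)
    also have "\<dots> \<le> ln (real n) powr D * real n powr (2 - \<beta>)"
      using A(3) n by (simp add: log_pow_eq_powr)
    also have "\<dots> \<le> ln (real n) powr D * real n powr (-1)"
      using n assms by (intro mult_left_mono powr_mono) auto
    also have "\<dots> < 1" using n(1) by (rule n1)
    finally show False by simp
  qed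
  thus ?thesis by (rule that)
qed

section \<open>Combination of the cases\<close>

theorem theorem3p3:
  fixes \<alpha> \<beta> D :: real
  assumes "\<alpha> > 0" and "\<beta> > 1/2" and "D \<ge> 0"
  shows "\<exists>c E :: real. c > 0 \<and> E \<ge> 0 \<and>
    (\<forall>(A :: real set) (n :: nat).
       finite A \<and> card A = n \<and>
       real (card (A + A)) \<le> real n powr (2 - \<alpha>) \<and>
       log_pow (real n) (- D) * real n powr (2 - \<beta>) \<le> real (card (A * A)) \<and>
       real (card (A * A)) \<le> log_pow (real n) D * real n powr (2 - \<beta>) \<longrightarrow>
       (\<exists>(B :: real set) (N :: nat) (M :: real) (G :: real set set).
          finite B \<and> card B = N \<and> N > n \<and>
          c * log_pow (real N) (- E) * real N powr (\<beta> / (3 - \<beta>)) \<le> M \<and>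
          M \<le> inverse c * log_pow (real N) E * real N powr ((2 - \<beta>) / (3 - \<beta>)) \<and>
          simple_graph B G \<and> (\<forall>e\<in>G. 0 \<notin> e) \<and>
          real (card G) \<ge>
            c * log_pow (real N) (- E) * M powr (1/2) * real N powr ((4 + \<beta>) / (6 - 2 * \<beta>)) \<and>
          real (card (graph_ratioset G)) \<le>
            inverse c * log_pow (real N) E * M * real N powr (1 / (3 - \<beta>)) \<and>
          real (card (graph_sumset G)) \<le>
            inverse c * log_pow (real N) E * real N powr ((2 - \<alpha>) / (3 - \<beta>))))"
proof (cases "\<beta> < 3")
  case True
  then obtain c1 E where 1: "0 < c1" "0 \<le> E"
    "\<And>(A :: real set) n. \<lbrakk>finite A; card A = n; 3 \<le> n; real (card (A + A)) \<le> real n powr (2 - \<alpha>);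
       log_pow (real n) (- D) * real n powr (2 - \<beta>) \<le> real (card (A * A));
       real (card (A * A)) \<le> log_pow (real n) D * real n powr (2 - \<beta>)\<rbrakk> \<Longrightarrow> admits_model \<alpha> \<beta> c1 E n"
    using large_admits_model[OF _ assms(3), of \<beta> \<alpha>] by metis
  \<comment> \<open>The cases \<open>n \<le> 2\<close>, where ln n may be less than 1, are covered
    with the same \<open>E\<close>, so only the constants have to be merged.\<close>
  obtain c2 where 2: "0 < c2" "\<And>n. n \<le> 2 \<Longrightarrow> admits_model \<alpha> \<beta> c2 E n"
    using bounded_admits_model by blast
  define c where "c = min c1 c2"
  have c: "0 < c" "c \<le> c1" "c \<le> c2" using 1 2 by (auto simp: c_def)
  have main: "admits_model \<alpha> \<beta> c E n"
    if "finite A" "card A = n" "real (card (A + A)) \<le> real n powr (2 - \<alpha>)"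
       "log_pow (real n) (- D) * real n powr (2 - \<beta>) \<le> real (card (A * A))"
       "real (card (A * A)) \<le> log_pow (real n) D * real n powr (2 - \<beta>)" for A :: "real set" and n
  proof (cases "3 \<le> n")
    case True
    from 1(3)[OF that(1,2) True that(3-5)] show ?thesis by (rule admits_model_mono[OF _ c(1,2)])
  next
    case False
    hence "admits_model \<alpha> \<beta> c2 E n" by (intro 2) simp
    thus ?thesis by (rule admits_model_mono[OF _ c(1,3)])
  qed
  show ?thesis
    unfolding admits_model_def[symmetric]
    by (rule exI[of _ c], rule exI[of _ E])
       (intro conjI allI impI c(1) 1(2); elim conjE; rule main; assumption)
next
  case False
  then obtain n0 where n0: "\<And>(A :: real set) n. \<lbrakk>finite A; card A = n;
      real (card (A * A)) \<le> log_pow (real n) D * real n powr (2 - \<beta>)\<rbrakk> \<Longrightarrow> n \<le> n0"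
    using card_bounded_if_exponent_ge_3[of \<beta> D] by auto
  \<comment> \<open>Since \<open>n\<close> is bounded here, no logarithmic loss is needed and
    \<open>E = 0\<close> works.\<close>
  obtain c where c: "0 < c" "\<And>n. n \<le> n0 \<Longrightarrow> admits_model \<alpha> \<beta> c 0 n"
    using bounded_admits_model by blast
  show ?thesis
    unfolding admits_model_def[symmetric]
    by (rule exI[of _ c], rule exI[of _ 0])
       (intro conjI allI impI c(1) order_refl; elim conjE; rule c(2); rule n0; assumption)
qed

end
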